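(* Let $h\in C^2(\mathbb{R}^n)$ be convex and $\mu>0$. Let $f:\mathbb{R}^n\to\mathbb{R}$, $f(x)=h(x)+\mu\|x\|_1$, and $F:\mathbb{R}^n\times\mathbb{R}^n\to\mathbb{R}$, $F(a,b)=h(a^2-b^2)+\mu\sum_{i=1}^n(a_i^2+b_i^2)$. Then there exists $\delta>0$ such that for all $(a,b)\in\mathbb{R}^n\times\mathbb{R}^n$, the following statements are equivalent: (i) The point $(a,b)$ is a stationary point of $F$ and $\lambda_{\min}(\nabla^2F(a,b))>-\delta$. (ii) The point $a^2-b^2$ is a global minimizer of $f$, and $\min\{a^2,b^2\}=0$. (iii) The point $(a,b)$ is a global minimizer of $F$. (iv) The point $(a,b)$ is a second-order stationary point of $F$.
   Context: For $a,b\in\mathbb{R}^n$, the notation $a^2$, $b^2$, $\min\{a^2,b^2\}$ denotes componentwise operations (vectors in $\mathbb{R}^n$). $\lambda_{\min}$ denotes the smallest eigenvalue of a symmetric matrix. A stationary point of $F$ is a point where $\nabla F=0$; a second-order stationary point of $F$ is a point where $\nabla F=0$ and $\nabla^2F\succeq 0$. *)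

theory Defs
  imports "HOL-Analysis.Analysis"
begin

definition gradient :: "('a::euclidean_space \<Rightarrow> real) \<Rightarrow> 'a \<Rightarrow> 'a" where
  "gradient f x = (THE D. GDERIV f x :> D)"

(* The Hessian at x, as the linear operator on the underlying inner product space which a choice of
   orthonormal basis turns into the usual matrix of second partial derivatives.  This covers
   R^n x R^n, with its standard inner product, without flattening it to R^(2n). *)
definition hessian :: "('a::euclidean_space \<Rightarrow> real) \<Rightarrow> 'a \<Rightarrow> 'a \<Rightarrow> 'a" where
  "hessian f x = frechet_derivative (gradient f) (at x)"

(* In finite dimension, continuity of x |-> hessian f x v for each fixed v is continuity of all
   matrix entries. *)
definition C2 :: "('a::euclidean_space \<Rightarrow> real) \<Rightarrow> bool" where
  "C2 f \<longleftrightarrow> f differentiable_on UNIV \<and> gradient f differentiable_on UNIV \<and>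
     (\<forall>v. continuous_on UNIV (\<lambda>x. hessian f x v))"

definition eigenvalues :: "('a::euclidean_space \<Rightarrow> 'a) \<Rightarrow> real set" where
  "eigenvalues A = {l. \<exists>v. v \<noteq> 0 \<and> A v = l *\<^sub>R v}"

(* Meant for self-adjoint linear A, where the set of eigenvalues is finite and nonempty. *)
definition lambda_min :: "('a::euclidean_space \<Rightarrow> 'a) \<Rightarrow> real" where
  "lambda_min A = Min (eigenvalues A)"

definition positive_semidefinite :: "('a::euclidean_space \<Rightarrow> 'a) \<Rightarrow> bool" where
  "positive_semidefinite A \<longleftrightarrow> (\<forall>v. 0 \<le> v \<bullet> A v)"

definition stationary_point :: "('a::euclidean_space \<Rightarrow> real) \<Rightarrow> 'a \<Rightarrow> bool" where
  "stationary_point f x \<longleftrightarrow> f differentiable (at x) \<and> gradient f x = 0"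

definition second_order_stationary_point :: "('a::euclidean_space \<Rightarrow> real) \<Rightarrow> 'a \<Rightarrow> bool" where
  "second_order_stationary_point f x \<longleftrightarrow>
     stationary_point f x \<and> positive_semidefinite (hessian f x)"

definition global_minimizer :: "('a \<Rightarrow> real) \<Rightarrow> 'a \<Rightarrow> bool" where
  "global_minimizer f x \<longleftrightarrow> (\<forall>y. f x \<le> f y)"

definition l1_norm :: "real ^ 'n \<Rightarrow> real" where
  "l1_norm x = (\<Sum>i\<in>UNIV. \<bar>x $ i\<bar>)"

(* The order on vectors is only partial, so the polymorphic min is not the componentwise minimum. *)
definition vec_min :: "real ^ 'n \<Rightarrow> real ^ 'n \<Rightarrow> real ^ 'n" where
  "vec_min x y = (\<chi> i. min (x $ i) (y $ i))"

(* The library's multiplication on vectors is componentwise, hence so is squaring. *)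
lemma vec_power2_component: "((a :: real ^ 'n)\<^sup>2) $ i = (a $ i)\<^sup>2"
  by (simp add: power2_eq_square)

lemma gradient_eqI:
  assumes "GDERIV f x :> D"
  shows "gradient f x = D"
  unfolding gradient_def
proof (rule the_equality)
  show "GDERIV f x :> D" by fact
next
  fix E assume "GDERIV f x :> E"
  then have "(\<lambda>h. h \<bullet> E) = (\<lambda>h. h \<bullet> D)"
    using assms unfolding gderiv_def by (rule has_derivative_unique)
  then show "E = D"
    by (metis vector_eq_rdot inner_commute)
qed

end

theory Submission
  imports Defs
begin

text \<open>Write \<open>x = a\<^sup>2 - b\<^sup>2\<close> and \<open>g\<close> for the gradient of \<open>h\<close> at \<open>x\<close>.  Stationarity of \<open>(a, b)\<close> says
  \<open>g\<^sub>i = -\<mu>\<close> where \<open>a\<^sub>i \<noteq> 0\<close> and \<open>g\<^sub>i = \<mu>\<close> where \<open>b\<^sub>i \<noteq> 0\<close>; only the bound on \<open>g\<^sub>i\<close> where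
  \<open>a\<^sub>i = b\<^sub>i = 0\<close> separates this from optimality of \<open>x\<close>.  There the Hessian has the eigenvalues
  \<open>2 (\<mu> + g\<^sub>i)\<close> and \<open>2 (\<mu> - g\<^sub>i)\<close>.  By convexity, \<open>g\<close> depends only on the supports of \<open>a\<close> and \<open>b\<close>
  at a stationary point, so these eigenvalues range over a finite set, and \<open>\<delta>\<close> is any gap
  between \<open>0\<close> and its negative elements.\<close>

section \<open>Gradients and Hessians\<close>

lemma gderiv_gradient:
  fixes f :: "'a::euclidean_space \<Rightarrow> real"
  assumes "f differentiable (at x)"
  shows "GDERIV f x :> gradient f x"
proof -
  obtain f' where f': "(f has_derivative f') (at x)"
    using assms unfolding differentiable_def by blast
  \<comment> \<open>Riesz representation: the adjoint of a functional, evaluated at 1, is its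
    representing vector.\<close>
  then have "f' = (\<lambda>v. v \<bullet> adjoint f' 1)"
    by (simp add: adjoint_works has_derivative_linear)
  then have "GDERIV f x :> adjoint f' 1"
    using f' unfolding gderiv_def by simp
  then show ?thesis
    using gradient_eqI by metis
qed

lemma gderiv_along_line:
  assumes "GDERIV f (x + t *\<^sub>R v) :> D"
  shows "((\<lambda>s. f (x + s *\<^sub>R v)) has_real_derivative v \<bullet> D) (at t)"
proof -
  have "((\<lambda>s. x + s *\<^sub>R v) has_derivative (\<lambda>s. s *\<^sub>R v)) (at t)"
    by (auto intro!: derivative_eq_intros)
  from has_derivative_compose[OF this assms[unfolded gderiv_def]] show ?thesis
    by (simp add: has_field_derivative_def mult.commute[of _ "v \<bullet> D"] o_def
        inner_scaleR_left mult_commute_abs)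
qed

lemma has_derivative_hessian:
  assumes "gradient f differentiable (at x)"
  shows "(gradient f has_derivative hessian f x) (at x)"
  unfolding hessian_def using assms by (simp add: frechet_derivative_works)

lemma linear_hessian:
  "gradient f differentiable (at x) \<Longrightarrow> linear (hessian f x)"
  using has_derivative_hessian has_derivative_linear by blast

text \<open>The second difference is symmetric in the two directions; applying the mean value theorem to
  only one of them uses no more than differentiability of the gradient at the base point.\<close>

lemma second_difference_tendsto_hessian:
  fixes f :: "'a::euclidean_space \<Rightarrow> real"
  assumes f: "\<And>y. f differentiable (at y)" and g: "gradient f differentiable (at x)"
  shows "((\<lambda>t. (f (x + t *\<^sub>R u + t *\<^sub>R v) - f (x + t *\<^sub>R u) - f (x + t *\<^sub>R v) + f x) / t\<^sup>2)
          \<longlongrightarrow> u \<bullet> hessian f x v) (at_right 0)"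
proof (rule tendstoI)
  fix e :: real assume "e > 0"
  define A where "A = hessian f x"
  define G where "G = gradient f"
  define M where "M = norm u + norm v + 1"
  \<comment> \<open>Two linearization errors of the gradient, each at most
    \<open>e' * (t * M)\<close>, are paired with \<open>u\<close>; this choice bounds the error of
    the quotient by \<open>e / 2\<close>.\<close>
  define e' where "e' = e / (4 * M * M)"
  have M: "M > 0" "norm u \<le> M" "norm v \<le> M" "norm u + norm v \<le> M"
    unfolding M_def by (simp_all add: add_nonneg_pos)
  have e': "e' > 0" using M \<open>e > 0\<close> by (simp add: e'_def)
  have A: "linear A" using linear_hessian[OF g] by (simp add: A_def)
  obtain d where d: "d > 0"
    and dd: "\<And>y. norm (y - x) < d \<Longrightarrow> norm (G y - G x - A (y - x)) \<le> e' * norm (y - x)"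
    using has_derivative_hessian[OF g] e' unfolding has_derivative_at_alt A_def G_def by blast
  have dd': "norm (G (x + w) - G x - A w) \<le> e' * norm w" if "norm w < d" for w
    using dd[of "x + w"] that by simp
  have "dist ((f (x + t *\<^sub>R u + t *\<^sub>R v) - f (x + t *\<^sub>R u) - f (x + t *\<^sub>R v) + f x) / t\<^sup>2) (u \<bullet> A v) < e"
    if t: "0 < t" "t < d / M" for t
  proof -
    have tM: "t * M < d" using t M by (simp add: pos_less_divide_eq)
    \<comment> \<open>Differencing in direction \<open>v\<close> first makes the second difference
      equal to \<open>p t - p 0\<close>, an increment in direction \<open>u\<close>.\<close>
    define p where "p = (\<lambda>s. f ((x + t *\<^sub>R v) + s *\<^sub>R u) - f (x + s *\<^sub>R u))"
    have "(p has_real_derivative (u \<bullet> (G (x + t *\<^sub>R v + s *\<^sub>R u) - G (x + s *\<^sub>R u)))) (at s)" for s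
      unfolding p_def inner_diff_right G_def
      by (intro DERIV_diff gderiv_along_line gderiv_gradient f)
    from MVT2[OF t(1) this] obtain s where s: "0 < s" "s < t"
      and ps: "p t - p 0 = t * (u \<bullet> (G (x + t *\<^sub>R v + s *\<^sub>R u) - G (x + s *\<^sub>R u)))" by auto
    define w where "w = t *\<^sub>R v + s *\<^sub>R u"
    have nsu: "norm (s *\<^sub>R u) \<le> t * M"
      using s M(2) by (simp add: mult_mono)
    have "norm w \<le> t * norm v + s * norm u"
      unfolding w_def using norm_triangle_ineq[of "t *\<^sub>R v" "s *\<^sub>R u"] s t by simp
    also have "\<dots> \<le> t * norm v + t * norm u" using s by (simp add: mult_right_mono)
    also have "\<dots> = t * (norm u + norm v)" by (simp add: algebra_simps)
    also have "\<dots> \<le> t * M" using t(1) M(4) by simp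
    finally have nw: "norm w \<le> t * M" .
    have 1: "norm (G (x + w) - G x - A w) \<le> e' * (t * M)"
      using dd'[of w] nw tM e' by (smt (verit) mult_left_mono)
    have 2: "norm (G (x + s *\<^sub>R u) - G x - A (s *\<^sub>R u)) \<le> e' * (t * M)"
      using dd'[of "s *\<^sub>R u"] nsu tM e' by (smt (verit) mult_left_mono)
    \<comment> \<open>Since \<open>A w - A (s *\<^sub>R u) = t *\<^sub>R A v\<close>, the remainder
      is a difference of two linearization errors at \<open>x\<close>.\<close>
    define R where "R = G (x + w) - G (x + s *\<^sub>R u) - t *\<^sub>R A v"
    have "R = (G (x + w) - G x - A w) - (G (x + s *\<^sub>R u) - G x - A (s *\<^sub>R u))"
      unfolding R_def w_def by (simp add: linear_add[OF A] linear_scale[OF A])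
    then have R: "norm R \<le> 2 * e' * (t * M)"
      using norm_triangle_ineq4[of "G (x + w) - G x - A w" "G (x + s *\<^sub>R u) - G x - A (s *\<^sub>R u)"] 1 2
      by simp
    have "p t - p 0 = t * (u \<bullet> (G (x + w) - G (x + s *\<^sub>R u)))"
      using ps by (simp add: w_def add.assoc)
    also have "\<dots> = t * (u \<bullet> R) + t\<^sup>2 * (u \<bullet> A v)"
      by (simp add: R_def inner_diff_right power2_eq_square algebra_simps)
    finally have "(p t - p 0) / t\<^sup>2 - u \<bullet> A v = (u \<bullet> R) / t"
      using t by (simp add: field_simps power2_eq_square)
    moreover have "\<bar>u \<bullet> R\<bar> / t < e"
    proof -
      have "\<bar>u \<bullet> R\<bar> \<le> norm u * norm R" by (rule Cauchy_Schwarz_ineq2)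
      also have "\<dots> \<le> M * (2 * e' * (t * M))" using R M by (intro mult_mono) auto
      also have "\<dots> = t * (e / 2)" using M by (simp add: e'_def)
      also have "\<dots> < t * e" using t \<open>e > 0\<close> by simp
      finally show ?thesis using t by (simp add: pos_divide_less_eq mult.commute)
    qed
    moreover have "f (x + t *\<^sub>R u + t *\<^sub>R v) - f (x + t *\<^sub>R u) - f (x + t *\<^sub>R v) + f x = p t - p 0"
      by (simp add: p_def algebra_simps)
    ultimately show ?thesis using t by (simp add: dist_real_def)
  qed
  moreover have "d / M > 0" using d M by simp
  ultimately show "\<forall>\<^sub>F t in at_right 0. dist ((f (x + t *\<^sub>R u + t *\<^sub>R v) - f (x + t *\<^sub>R u)
      - f (x + t *\<^sub>R v) + f x) / t\<^sup>2) (u \<bullet> hessian f x v) < e"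
    unfolding eventually_at_right_field A_def by blast
qed

text \<open>Exchanging \<open>u\<close> and \<open>v\<close> leaves the second difference unchanged,
  so the two limits agree. This makes the eigenvalue results below applicable to Hessians.\<close>

lemma hessian_self_adjoint:
  fixes f :: "'a::euclidean_space \<Rightarrow> real"
  assumes "\<And>y. f differentiable (at y)" and "gradient f differentiable (at x)"
  shows "u \<bullet> hessian f x v = hessian f x u \<bullet> v"
proof -
  have "((\<lambda>t. (f (x + t *\<^sub>R u + t *\<^sub>R v) - f (x + t *\<^sub>R u) - f (x + t *\<^sub>R v) + f x) / t\<^sup>2)
      \<longlongrightarrow> v \<bullet> hessian f x u) (at_right 0)"
    using second_difference_tendsto_hessian[OF assms, of v u] by (simp add: algebra_simps)
  with second_difference_tendsto_hessian[OF assms, of u v]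
  have "u \<bullet> hessian f x v = v \<bullet> hessian f x u"
    by (rule tendsto_unique[rotated]) simp
  then show ?thesis by (simp add: inner_commute)
qed

lemma global_minimizer_stationary:
  fixes f :: "'a::euclidean_space \<Rightarrow> real"
  assumes "global_minimizer f x" and "f differentiable (at x)"
  shows "stationary_point f x"
proof -
  have "(\<lambda>v. v \<bullet> gradient f x) = (\<lambda>v. 0)"
    using differential_zero_maxmin[OF UNIV_I open_UNIV gderiv_gradient[OF assms(2), unfolded gderiv_def]]
      assms(1) unfolding global_minimizer_def by auto
  then have "gradient f x \<bullet> gradient f x = 0" by metis
  then show ?thesis using assms(2) by (simp add: stationary_point_def)
qed

text \<open>Along a direction of negative curvature the directional derivative starts at 0 and turns
  negative at once, so the mean value theorem yields a strictly smaller value.\<close>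

lemma global_minimizer_second_order:
  fixes f :: "'a::euclidean_space \<Rightarrow> real"
  assumes min: "global_minimizer f x" and f: "\<And>y. f differentiable (at y)"
    and g: "gradient f differentiable (at x)"
  shows "second_order_stationary_point f x"
proof -
  have st: "stationary_point f x" by (rule global_minimizer_stationary[OF min f])
  have "0 \<le> v \<bullet> hessian f x v" for v
  proof (rule ccontr)
    assume neg: "\<not> 0 \<le> v \<bullet> hessian f x v"
    define q where "q = (\<lambda>t. v \<bullet> gradient f (x + t *\<^sub>R v))"
    have "((\<lambda>t. x + t *\<^sub>R v) has_derivative (\<lambda>t. t *\<^sub>R v)) (at 0)"
      by (auto intro!: derivative_eq_intros)
    moreover have "(gradient f has_derivative hessian f x) (at (x + 0 *\<^sub>R v))"
      using has_derivative_hessian[OF g] by simp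
    ultimately have "((\<lambda>t. gradient f (x + t *\<^sub>R v)) has_derivative (\<lambda>t. hessian f x (t *\<^sub>R v))) (at 0)"
      by (rule has_derivative_compose)
    from has_derivative_inner_right[OF this, of v]
    have "(q has_real_derivative v \<bullet> hessian f x v) (at 0)"
      unfolding q_def has_field_derivative_def
      by (simp add: linear_scale[OF linear_hessian[OF g]] mult_commute_abs)
    from DERIV_neg_dec_right[OF this] neg obtain d where d: "d > 0"
      and q: "\<And>t. 0 < t \<Longrightarrow> t < d \<Longrightarrow> q t < q 0" by force
    have "q 0 = 0" using st by (simp add: q_def stationary_point_def)
    have "((\<lambda>t. f (x + t *\<^sub>R v)) has_real_derivative q t) (at t)" for t
      unfolding q_def by (intro gderiv_along_line gderiv_gradient f)
    from MVT2[of 0 "d/2", OF _ this] d obtain t where t: "0 < t" "t < d / 2"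
      and ft: "f (x + (d/2) *\<^sub>R v) - f x = d / 2 * q t" by auto
    have "q t < 0" using q[of t] t \<open>q 0 = 0\<close> by simp
    then have "f (x + (d/2) *\<^sub>R v) < f x" using ft d by (smt (verit) half_gt_zero mult_pos_neg)
    then show False using min by (simp add: global_minimizer_def not_le[symmetric])
  qed
  then show ?thesis using st
    by (simp add: second_order_stationary_point_def positive_semidefinite_def)
qed

section \<open>Eigenvalues of self-adjoint operators\<close>

text \<open>Eigenvectors for distinct eigenvalues are orthogonal, hence linearly
  independent.\<close>

lemma finite_eigenvalues:
  fixes A :: "'a::euclidean_space \<Rightarrow> 'a"
  assumes sa: "\<And>u v. u \<bullet> A v = A u \<bullet> v"
  shows "finite (eigenvalues A)"
proof -
  obtain e where e: "\<And>l. l \<in> eigenvalues A \<Longrightarrow> e l \<noteq> 0 \<and> A (e l) = l *\<^sub>R e l"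
    using bchoice[of "eigenvalues A" "\<lambda>l v. v \<noteq> 0 \<and> A v = l *\<^sub>R v"]
    unfolding eigenvalues_def by blast
  have orth: "e l \<bullet> e m = 0" if "l \<in> eigenvalues A" "m \<in> eigenvalues A" "l \<noteq> m" for l m
    using sa[of "e l" "e m"] e[OF that(1)] e[OF that(2)] that(3) by simp
  have inj: "inj_on e (eigenvalues A)"
    using orth e by (metis inj_onI inner_eq_zero_iff)
  have "pairwise orthogonal (e ` eigenvalues A)"
    unfolding pairwise_def orthogonal_def using orth by blast
  moreover have "0 \<notin> e ` eigenvalues A" using e by force
  ultimately have "finite (e ` eigenvalues A)"
    using pairwise_orthogonal_independent independent_imp_finite by blast
  then show ?thesis using inj finite_imageD by blast
qed

text \<open>A minimizer \<open>v\<close> of the Rayleigh quotient on the unit sphere is an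
  eigenvector: otherwise moving \<open>v\<close> against the residual \<open>r\<close> would lower
  the quotient.\<close>

lemma eigenvalues_nonempty:
  fixes A :: "'a::euclidean_space \<Rightarrow> 'a"
  assumes lin: "linear A" and sa: "\<And>u v. u \<bullet> A v = A u \<bullet> v"
  shows "eigenvalues A \<noteq> {}"
proof -
  have "continuous_on (sphere 0 1) (\<lambda>v. v \<bullet> A v)"
    by (intro continuous_intros linear_continuous_on linear_conv_bounded_linear[THEN iffD1] lin)
  then obtain v where v: "norm v = 1" and vmin: "\<And>w. norm w = 1 \<Longrightarrow> v \<bullet> A v \<le> w \<bullet> A w"
    using continuous_attains_inf[of "sphere (0::'a) 1" "\<lambda>v. v \<bullet> A v"] by auto
  define l where "l = v \<bullet> A v"
  define r where "r = A v - l *\<^sub>R v"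
  have rayleigh: "l * (w \<bullet> w) \<le> w \<bullet> A w" for w
  proof (cases "w = 0")
    case False
    define c where "c = 1 / norm w"
    have "norm (c *\<^sub>R w) = 1" using False by (simp add: c_def)
    from vmin[OF this] have "l \<le> c * c * (w \<bullet> A w)"
      by (simp add: l_def linear_scale[OF lin])
    then show ?thesis using False
      by (simp add: c_def dot_square_norm field_simps power2_eq_square)
  qed (simp add: linear_0[OF lin])
  define q where "q = r \<bullet> A r - l * (r \<bullet> r)"
  have "q \<ge> 0" using rayleigh[of r] by (simp add: q_def)
  have Av: "A v = l *\<^sub>R v + r" by (simp add: r_def)
  have vv: "v \<bullet> v = 1" using v by (simp add: dot_square_norm)
  have vr: "v \<bullet> r = 0" by (simp add: r_def inner_diff_right vv flip: l_def)
  \<comment> \<open>The Rayleigh inequality at \<open>v + t *\<^sub>R r\<close>; the terms of order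
    0 in \<open>t\<close> cancel.\<close>
  have quad: "0 \<le> 2 * t * (r \<bullet> r) + t\<^sup>2 * q" for t
  proof -
    have "v \<bullet> A r = r \<bullet> r"
      using vr by (simp add: sa Av inner_add_left)
    moreover have "r \<bullet> A v = r \<bullet> r" using vr by (simp add: Av inner_add_right inner_commute)
    ultimately have "(v + t *\<^sub>R r) \<bullet> A (v + t *\<^sub>R r) = l + 2 * t * (r \<bullet> r) + t\<^sup>2 * (r \<bullet> A r)"
      by (simp add: linear_add[OF lin] linear_scale[OF lin] inner_add_left inner_add_right
          power2_eq_square algebra_simps flip: l_def)
    moreover have "(v + t *\<^sub>R r) \<bullet> (v + t *\<^sub>R r) = 1 + t\<^sup>2 * (r \<bullet> r)"
      using vr vv by (simp add: inner_add_left inner_add_right power2_eq_square inner_commute)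
    ultimately show ?thesis
      using rayleigh[of "v + t *\<^sub>R r"] by (simp add: q_def algebra_simps)
  qed
  have "r \<bullet> r \<le> 0"
  proof (rule ccontr)
    assume "\<not> r \<bullet> r \<le> 0"
    then have pos: "r \<bullet> r > 0" by (simp only: not_le)
    \<comment> \<open>A negative \<open>t\<close> small enough for the linear term to dominate;
      \<open>q + 1\<close> in place of \<open>q\<close> keeps the denominator positive.\<close>
    define t where "t = - (r \<bullet> r) / (q + 1)"
    have "t < 0" using pos \<open>q \<ge> 0\<close> by (simp add: t_def)
    have "t * (q + 1) = - (r \<bullet> r)" using \<open>q \<ge> 0\<close> by (simp add: t_def)
    then have "2 * (r \<bullet> r) + t * q = (r \<bullet> r) - t" by (simp add: algebra_simps)
    then have "2 * (r \<bullet> r) + t * q > 0" using pos \<open>t < 0\<close> by linarith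
    with \<open>t < 0\<close> have "t * (2 * (r \<bullet> r) + t * q) < 0" by (rule mult_neg_pos)
    then show False using quad[of t] by (simp add: algebra_simps power2_eq_square)
  qed
  then have "r = 0" by (metis inner_eq_zero_iff inner_ge_zero order_antisym)
  then have "l \<in> eigenvalues A" using Av v by (auto simp: eigenvalues_def intro!: exI[of _ v])
  then show ?thesis by blast
qed

lemma lambda_min_le_eigenvalue:
  fixes A :: "'a::euclidean_space \<Rightarrow> 'a"
  assumes "\<And>u v. u \<bullet> A v = A u \<bullet> v" and "v \<noteq> 0" and "A v = l *\<^sub>R v"
  shows "lambda_min A \<le> l"
  unfolding lambda_min_def
  by (rule Min_le) (use assms finite_eigenvalues in \<open>auto simp: eigenvalues_def\<close>)

text \<open>The eigenvalue set is finite and nonempty, so its \<open>Min\<close> has an eigenvector,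
  on which semidefiniteness is tested. This supplies the spectral half of (iv) implies (i).\<close>

lemma lambda_min_nonneg:
  fixes A :: "'a::euclidean_space \<Rightarrow> 'a"
  assumes "linear A" and "\<And>u v. u \<bullet> A v = A u \<bullet> v" and "positive_semidefinite A"
  shows "0 \<le> lambda_min A"
proof -
  have "lambda_min A \<in> eigenvalues A"
    unfolding lambda_min_def using assms by (intro Min_in finite_eigenvalues eigenvalues_nonempty) auto
  then obtain v where "v \<noteq> 0" "A v = lambda_min A *\<^sub>R v" by (auto simp: eigenvalues_def)
  moreover have "0 \<le> v \<bullet> A v" using assms(3) by (simp add: positive_semidefinite_def)
  moreover have "v \<bullet> v > 0" using calculation(1) by simp
  ultimately show ?thesis by (simp add: zero_le_mult_iff not_le)
qed

section \<open>Convex functions\<close>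

text \<open>Restriction to the line through \<open>x\<close> and \<open>y\<close> reduces this to
  the tangent inequality in one variable.\<close>

lemma convex_on_above_gradient:
  fixes h :: "'a::euclidean_space \<Rightarrow> real"
  assumes conv: "convex_on UNIV h" and D: "GDERIV h x :> D"
  shows "h x + D \<bullet> (y - x) \<le> h y"
proof -
  define p where "p = (\<lambda>t. h (x + t *\<^sub>R (y - x)))"
  have "convex_on UNIV p"
  proof (rule convex_onI)
    fix t s r :: real assume "0 < t" "t < 1"
    have "x + ((1 - t) *\<^sub>R s + t *\<^sub>R r) *\<^sub>R (y - x)
        = (1 - t) *\<^sub>R (x + s *\<^sub>R (y - x)) + t *\<^sub>R (x + r *\<^sub>R (y - x))"
      by (simp add: algebra_simps)
    then show "p ((1 - t) *\<^sub>R s + t *\<^sub>R r) \<le> (1 - t) * p s + t * p r"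
      unfolding p_def using convex_onD[OF conv, of t "x + s *\<^sub>R (y - x)" "x + r *\<^sub>R (y - x)"]
        \<open>0 < t\<close> \<open>t < 1\<close> by simp
  qed simp
  moreover have "(p has_real_derivative (y - x) \<bullet> D) (at 0)"
    unfolding p_def by (rule gderiv_along_line) (use D in simp)
  ultimately have "((y - x) \<bullet> D) * (1 - 0) \<le> p 1 - p 0"
    by (intro convex_on_imp_above_tangent[where A = UNIV]) auto
  then show ?thesis by (simp add: p_def inner_commute)
qed

text \<open>The equality says that \<open>y\<close> is a zero, hence a minimizer, of the Bregman distance to \<open>x\<close>,
  whose gradient at \<open>y\<close> therefore vanishes.\<close>

lemma convex_tangent_gradient_eq:
  fixes h :: "'a::euclidean_space \<Rightarrow> real"
  assumes conv: "convex_on UNIV h" and D: "GDERIV h x :> D" and E: "GDERIV h y :> E"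
    and eq: "h y = h x + D \<bullet> (y - x)"
  shows "E = D"
proof -
  define B where "B = (\<lambda>z. h z - h x - D \<bullet> (z - x))"
  have "(B has_derivative (\<lambda>v. v \<bullet> E - D \<bullet> v)) (at y)"
    unfolding B_def using E[unfolded gderiv_def] by (auto intro!: derivative_eq_intros)
  then have "(\<lambda>v. v \<bullet> E - D \<bullet> v) = (\<lambda>v. 0)"
    by (rule differential_zero_maxmin[OF UNIV_I open_UNIV])
       (use convex_on_above_gradient[OF conv D] eq in \<open>auto simp: B_def algebra_simps\<close>)
  \<comment> \<open>Testing the vanishing differential on \<open>E - D\<close> produces a squared
    norm.\<close>
  then have "(E - D) \<bullet> E - D \<bullet> (E - D) = 0" by metis
  then have "(E - D) \<bullet> (E - D) = 0" by (simp add: algebra_simps inner_commute)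
  then show ?thesis by simp
qed

section \<open>The lifted objective\<close>

text \<open>Gives componentwise products and squares a product rule.\<close>

lemma bounded_bilinear_vec_times:
  "bounded_bilinear ((*) :: real ^ 'n \<Rightarrow> real ^ 'n \<Rightarrow> real ^ 'n)"
  unfolding bilinear_conv_bounded_bilinear[symmetric] bilinear_def
  by (auto intro!: linearI simp: algebra_simps)

lemmas has_derivative_vec_times = bounded_bilinear.FDERIV[OF bounded_bilinear_vec_times]

definition lifted :: "(real ^ 'n \<Rightarrow> real) \<Rightarrow> real \<Rightarrow> (real ^ 'n) \<times> (real ^ 'n) \<Rightarrow> real" where
  "lifted h \<mu> = (\<lambda>(a, b). h (a\<^sup>2 - b\<^sup>2) + \<mu> * (\<Sum>i\<in>UNIV. (a $ i)\<^sup>2 + (b $ i)\<^sup>2))"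

definition lifted_gradient ::
  "(real ^ 'n \<Rightarrow> real) \<Rightarrow> real \<Rightarrow> (real ^ 'n) \<times> (real ^ 'n) \<Rightarrow> (real ^ 'n) \<times> (real ^ 'n)" where
  "lifted_gradient h \<mu> = (\<lambda>(a, b).
     (2 *\<^sub>R (a * (vec \<mu> + gradient h (a\<^sup>2 - b\<^sup>2))), 2 *\<^sub>R (b * (vec \<mu> - gradient h (a\<^sup>2 - b\<^sup>2)))))"

lemma has_derivative_square_diff:
  "((\<lambda>z. (fst z)\<^sup>2 - (snd z)\<^sup>2) has_derivative (\<lambda>(u, v). 2 *\<^sub>R (a * u - b * v))) (at (a, b))"
  for a b :: "real ^ 'n"
proof -
  have "((\<lambda>z. fst z * fst z - snd z * snd z) has_derivative
      (\<lambda>w. (fst (a, b) * fst w + fst w * fst (a, b)) - (snd (a, b) * snd w + snd w * snd (a, b)))) (at (a, b))"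
    by (intro has_derivative_diff has_derivative_vec_times has_derivative_fst has_derivative_snd
        has_derivative_ident)
  moreover have "(\<lambda>w. (fst (a, b) * fst w + fst w * fst (a, b)) - (snd (a, b) * snd w + snd w * snd (a, b)))
      = (\<lambda>(u, v). 2 *\<^sub>R (a * u - b * v))"
    by (auto simp: fun_eq_iff vec_eq_iff algebra_simps)
  ultimately show ?thesis by (simp only: power2_eq_square)
qed

lemma gderiv_lifted:
  fixes h :: "real ^ 'n \<Rightarrow> real"
  assumes h: "\<And>x. h differentiable (at x)"
  shows "GDERIV (lifted h \<mu>) z :> lifted_gradient h \<mu> z"
proof (cases z)
  case (Pair a b)
  define g where "g = gradient h (a\<^sup>2 - b\<^sup>2)"
  have "(h has_derivative (\<lambda>w. w \<bullet> g)) (at ((fst (a, b))\<^sup>2 - (snd (a, b))\<^sup>2))"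
    using gderiv_gradient[OF h, of "a\<^sup>2 - b\<^sup>2"] by (simp add: gderiv_def g_def)
  from has_derivative_compose[OF has_derivative_square_diff this]
  have 1: "((\<lambda>z. h ((fst z)\<^sup>2 - (snd z)\<^sup>2)) has_derivative
      (\<lambda>w. (case w of (u, v) \<Rightarrow> 2 *\<^sub>R (a * u - b * v)) \<bullet> g)) (at (a, b))" .
  have 2: "((\<lambda>z. \<mu> * (fst z \<bullet> fst z + snd z \<bullet> snd z)) has_derivative
      (\<lambda>w. \<mu> * ((a \<bullet> fst w + fst w \<bullet> a) + (b \<bullet> snd w + snd w \<bullet> b)))) (at (a, b))"
    by (auto intro!: derivative_eq_intros)
  have "lifted h \<mu> = (\<lambda>z. h ((fst z)\<^sup>2 - (snd z)\<^sup>2) + \<mu> * (fst z \<bullet> fst z + snd z \<bullet> snd z))"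
    by (auto simp: lifted_def fun_eq_iff inner_vec_def power2_eq_square sum.distrib)
  moreover have "(\<lambda>w. (case w of (u, v) \<Rightarrow> 2 *\<^sub>R (a * u - b * v)) \<bullet> g
        + \<mu> * ((a \<bullet> fst w + fst w \<bullet> a) + (b \<bullet> snd w + snd w \<bullet> b)))
      = (\<lambda>w. w \<bullet> lifted_gradient h \<mu> (a, b))"
    by (auto simp: fun_eq_iff lifted_gradient_def inner_Pair inner_vec_def sum_distrib_left
        sum.distrib[symmetric] g_def[symmetric] algebra_simps intro!: sum.cong)
  ultimately show ?thesis
    using has_derivative_add[OF 1 2] by (simp add: Pair gderiv_def)
qed

lemma gradient_lifted:
  fixes h :: "real ^ 'n \<Rightarrow> real"
  assumes "\<And>x. h differentiable (at x)"
  shows "gradient (lifted h \<mu>) = lifted_gradient h \<mu>"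
  using gradient_eqI[OF gderiv_lifted[OF assms]] by blast

text \<open>Product rule: \<open>A u v\<close> is the derivative of \<open>gradient h\<close>
  composed with the square difference, in direction \<open>(u, v)\<close>.\<close>

lemma has_derivative_lifted_gradient:
  fixes h :: "real ^ 'n \<Rightarrow> real"
  assumes "gradient h differentiable (at (a\<^sup>2 - b\<^sup>2))"
  defines "g \<equiv> gradient h (a\<^sup>2 - b\<^sup>2)"
    and "A \<equiv> \<lambda>u v. hessian h (a\<^sup>2 - b\<^sup>2) (2 *\<^sub>R (a * u - b * v))"
  shows "(lifted_gradient h \<mu> has_derivative
    (\<lambda>(u, v). (2 *\<^sub>R (a * A u v + u * (vec \<mu> + g)), 2 *\<^sub>R (v * (vec \<mu> - g) - b * A u v)))) (at (a, b))"
proof -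
  have "(gradient h has_derivative hessian h (a\<^sup>2 - b\<^sup>2)) (at ((fst (a, b))\<^sup>2 - (snd (a, b))\<^sup>2))"
    using has_derivative_hessian[OF assms(1)] by simp
  from has_derivative_compose[OF has_derivative_square_diff this]
  have 1: "((\<lambda>z. gradient h ((fst z)\<^sup>2 - (snd z)\<^sup>2)) has_derivative (\<lambda>w. A (fst w) (snd w))) (at (a, b))"
    by (simp add: A_def case_prod_beta)
  have "((\<lambda>z. (2 *\<^sub>R (fst z * (vec \<mu> + gradient h ((fst z)\<^sup>2 - (snd z)\<^sup>2))),
        2 *\<^sub>R (snd z * (vec \<mu> - gradient h ((fst z)\<^sup>2 - (snd z)\<^sup>2))))) has_derivative
      (\<lambda>w. (2 *\<^sub>R (fst (a, b) * (0 + A (fst w) (snd w)) + fst w * (vec \<mu> + g)),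
        2 *\<^sub>R (snd (a, b) * (0 - A (fst w) (snd w)) + snd w * (vec \<mu> - g))))) (at (a, b))"
    unfolding g_def
    using has_derivative_vec_times[OF has_derivative_fst[OF has_derivative_ident]
        has_derivative_add[OF has_derivative_const[of "vec \<mu>"] 1]]
      has_derivative_vec_times[OF has_derivative_snd[OF has_derivative_ident]
        has_derivative_diff[OF has_derivative_const[of "vec \<mu>"] 1]]
    by (intro has_derivative_Pair has_derivative_scaleR_right) simp_all
  then show ?thesis
    by (simp add: lifted_gradient_def case_prod_unfold)
qed

lemma gradient_lifted_differentiable:
  fixes h :: "real ^ 'n \<Rightarrow> real"
  assumes "\<And>x. h differentiable (at x)" and "\<And>x. gradient h differentiable (at x)"
  shows "gradient (lifted h \<mu>) differentiable (at z)"
  unfolding gradient_lifted[OF assms(1)] differentiable_def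
  using has_derivative_lifted_gradient[OF assms(2)] by (cases z) blast

lemma hessian_lifted:
  fixes h :: "real ^ 'n \<Rightarrow> real"
  assumes "\<And>x. h differentiable (at x)" and "gradient h differentiable (at (a\<^sup>2 - b\<^sup>2))"
  defines "g \<equiv> gradient h (a\<^sup>2 - b\<^sup>2)"
    and "A \<equiv> \<lambda>u v. hessian h (a\<^sup>2 - b\<^sup>2) (2 *\<^sub>R (a * u - b * v))"
  shows "hessian (lifted h \<mu>) (a, b) =
    (\<lambda>(u, v). (2 *\<^sub>R (a * A u v + u * (vec \<mu> + g)), 2 *\<^sub>R (v * (vec \<mu> - g) - b * A u v)))"
  unfolding hessian_def[of "lifted h \<mu>"] gradient_lifted[OF assms(1)] g_def A_def
  by (rule frechet_derivative_at[OF has_derivative_lifted_gradient[OF assms(2)], symmetric])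

text \<open>Where both coordinates vanish, moving along either of them leaves the square difference
  unchanged to first order. The Hessian of \<open>h\<close> then drops out and only the diagonal
  terms remain.\<close>

lemma hessian_lifted_eigenvectors:
  fixes h :: "real ^ 'n \<Rightarrow> real"
  assumes h: "\<And>x. h differentiable (at x)" "\<And>x. gradient h differentiable (at x)"
    and zero: "a $ i = 0" "b $ i = 0"
  defines "g \<equiv> gradient h (a\<^sup>2 - b\<^sup>2)"
  shows "hessian (lifted h \<mu>) (a, b) (axis i 1, 0) = (2 * (\<mu> + g $ i)) *\<^sub>R (axis i 1, 0)"
    and "hessian (lifted h \<mu>) (a, b) (0, axis i 1) = (2 * (\<mu> - g $ i)) *\<^sub>R (0, axis i 1)"
proof -
  have *: "a * axis i 1 = 0" "b * axis i 1 = 0"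
    using zero by (auto simp: vec_eq_iff axis_def)
  show "hessian (lifted h \<mu>) (a, b) (axis i 1, 0) = (2 * (\<mu> + g $ i)) *\<^sub>R (axis i 1, 0)"
    "hessian (lifted h \<mu>) (a, b) (0, axis i 1) = (2 * (\<mu> - g $ i)) *\<^sub>R (0, axis i 1)"
    unfolding hessian_lifted[OF h(1) h(2)]
    by (simp_all add: * linear_0[OF linear_hessian[OF h(2)]] g_def) (auto simp: vec_eq_iff axis_def)
qed

section \<open>Stationary points and global minimizers of the lifted objective\<close>

lemma stationary_point_lifted_iff:
  fixes h :: "real ^ 'n \<Rightarrow> real"
  assumes "\<And>x. h differentiable (at x)"
  shows "stationary_point (lifted h \<mu>) (a, b) \<longleftrightarrow>
    (\<forall>i. (a $ i = 0 \<or> gradient h (a\<^sup>2 - b\<^sup>2) $ i = - \<mu>) \<and> (b $ i = 0 \<or> gradient h (a\<^sup>2 - b\<^sup>2) $ i = \<mu>))"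
proof -
  have "lifted h \<mu> differentiable (at (a, b))"
    using gderiv_lifted[OF assms] unfolding gderiv_def differentiable_def by blast
  then show ?thesis
    by (auto simp: stationary_point_def gradient_lifted[OF assms] lifted_gradient_def zero_prod_def
        vec_eq_iff eq_neg_iff_add_eq_0 add.commute)
qed

text \<open>Sums the scalar identity p + q = |p - q| + 2 min(p, q). For positive \<mu>, the lifted
  objective thus exceeds f by a nonnegative overlap term.\<close>

lemma lifted_eq:
  fixes h :: "real ^ 'n \<Rightarrow> real"
  shows "lifted h \<mu> (a, b) =
    h (a\<^sup>2 - b\<^sup>2) + \<mu> * l1_norm (a\<^sup>2 - b\<^sup>2) + 2 * \<mu> * (\<Sum>i\<in>UNIV. vec_min (a\<^sup>2) (b\<^sup>2) $ i)"
proof -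
  have "(a $ i)\<^sup>2 + (b $ i)\<^sup>2 = \<bar>(a\<^sup>2 - b\<^sup>2) $ i\<bar> + 2 * vec_min (a\<^sup>2) (b\<^sup>2) $ i" for i
    by (simp add: vec_min_def vec_power2_component)
  then show ?thesis
    unfolding lifted_def l1_norm_def prod.case
    by (simp only: sum.distrib sum_distrib_left[symmetric]) (simp add: algebra_simps)
qed

lemma vec_min_squares_nonneg: "0 \<le> vec_min (a\<^sup>2) (b\<^sup>2) $ i" for a b :: "real ^ 'n"
  by (simp add: vec_min_def vec_power2_component)

text \<open>Roots of the positive and negative parts of \<open>y\<close>; hence every value of f is
  also a value of the lifted objective.\<close>

lemma ex_square_diff:
  fixes y :: "real ^ 'n"
  obtains a b :: "real ^ 'n" where "a\<^sup>2 - b\<^sup>2 = y" and "vec_min (a\<^sup>2) (b\<^sup>2) = 0"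
proof
  let ?a = "\<chi> i. sqrt (max (y $ i) 0)" and ?b = "\<chi> i. sqrt (max (- y $ i) 0)"
  show "?a\<^sup>2 - ?b\<^sup>2 = y" "vec_min (?a\<^sup>2) (?b\<^sup>2) = 0"
    by (auto simp: vec_eq_iff vec_power2_component vec_min_def)
qed

lemma global_minimizer_lifted_iff:
  fixes h :: "real ^ 'n \<Rightarrow> real"
  assumes mu: "\<mu> > 0"
  shows "global_minimizer (lifted h \<mu>) (a, b) \<longleftrightarrow>
    global_minimizer (\<lambda>x. h x + \<mu> * l1_norm x) (a\<^sup>2 - b\<^sup>2) \<and> vec_min (a\<^sup>2) (b\<^sup>2) = 0"
    (is "?L \<longleftrightarrow> global_minimizer ?f _ \<and> _")
proof
  define S where "S = (\<lambda>a b :: real ^ 'n. \<Sum>i\<in>UNIV. vec_min (a\<^sup>2) (b\<^sup>2) $ i)"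
  have S: "S a b \<ge> 0" for a b unfolding S_def by (intro sum_nonneg vec_min_squares_nonneg)
  have eq: "lifted h \<mu> (a, b) = ?f (a\<^sup>2 - b\<^sup>2) + 2 * \<mu> * S a b" for a b
    by (simp add: lifted_eq S_def)
  have S0: "S a b = 0 \<longleftrightarrow> vec_min (a\<^sup>2) (b\<^sup>2) = 0" for a b
    unfolding S_def by (subst sum_nonneg_eq_0_iff) (auto simp: vec_min_squares_nonneg vec_eq_iff)
  {
    assume L: ?L
    have le: "?f (a\<^sup>2 - b\<^sup>2) + 2 * \<mu> * S a b \<le> ?f y" for y
    proof -
      obtain c d where "c\<^sup>2 - d\<^sup>2 = y" "vec_min (c\<^sup>2) (d\<^sup>2) = 0" by (rule ex_square_diff)
      then have "lifted h \<mu> (c, d) = ?f y" using eq[of c d] S0[of c d] by simp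
      then show ?thesis using L unfolding global_minimizer_def eq by (metis eq)
    qed
    \<comment> \<open>Comparison with the point's own square difference leaves only the overlap
      term, which must therefore vanish.\<close>
    have "S a b = 0" using le[of "a\<^sup>2 - b\<^sup>2"] mu S[of a b] by (simp add: mult_le_0_iff)
    then show "global_minimizer ?f (a\<^sup>2 - b\<^sup>2) \<and> vec_min (a\<^sup>2) (b\<^sup>2) = 0"
      using le S0[of a b] by (simp add: global_minimizer_def)
  }
  assume R: "global_minimizer ?f (a\<^sup>2 - b\<^sup>2) \<and> vec_min (a\<^sup>2) (b\<^sup>2) = 0"
  have "lifted h \<mu> (a, b) \<le> lifted h \<mu> (c, d)" for c d
  proof -
    have "lifted h \<mu> (a, b) = ?f (a\<^sup>2 - b\<^sup>2)" using R S0[of a b] by (simp add: eq)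
    also have "\<dots> \<le> ?f (c\<^sup>2 - d\<^sup>2)" using R by (simp add: global_minimizer_def)
    also have "\<dots> \<le> lifted h \<mu> (c, d)" using mu S[of c d] by (simp add: eq)
    finally show ?thesis .
  qed
  then show ?L by (auto simp: global_minimizer_def)
qed

text \<open>The bound on the gradient is what stationarity misses: together they say that the negative
  gradient of \<open>h\<close> is \<open>\<mu>\<close> times a subgradient of the \<open>l1\<close> norm.\<close>

lemma stationary_lifted_imp_minimizer:
  fixes h :: "real ^ 'n \<Rightarrow> real"
  assumes h: "\<And>x. h differentiable (at x)" and conv: "convex_on UNIV h"
    and st: "stationary_point (lifted h \<mu>) (a, b)"
    and bound: "\<And>i. \<bar>gradient h (a\<^sup>2 - b\<^sup>2) $ i\<bar> \<le> \<mu>"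
  shows "global_minimizer (\<lambda>x. h x + \<mu> * l1_norm x) (a\<^sup>2 - b\<^sup>2)"
  unfolding global_minimizer_def
proof
  fix y
  define x where "x = a\<^sup>2 - b\<^sup>2"
  define g where "g = gradient h x"
  have comp: "\<mu> * \<bar>x $ i\<bar> - g $ i * (y $ i - x $ i) \<le> \<mu> * \<bar>y $ i\<bar>" for i
  proof -
    \<comment> \<open>Complementarity: stationarity makes \<open>g $ i\<close> equal to -\<mu> times
      the sign of \<open>x $ i\<close> wherever \<open>x $ i\<close> is nonzero.\<close>
    have "\<mu> * \<bar>x $ i\<bar> + g $ i * x $ i = 0"
      using st[unfolded stationary_point_lifted_iff[OF h], rule_format, of i]
      by (auto simp: g_def x_def vec_power2_component)
    moreover have "- (g $ i * y $ i) \<le> \<mu> * \<bar>y $ i\<bar>"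
      using bound[of i] abs_ge_minus_self[of "g $ i * y $ i"] mult_right_mono[of "\<bar>g $ i\<bar>" \<mu> "\<bar>y $ i\<bar>"]
      by (simp add: g_def x_def abs_mult)
    ultimately show ?thesis by (simp add: algebra_simps)
  qed
  have "\<mu> * l1_norm x - g \<bullet> (y - x) = (\<Sum>i\<in>UNIV. \<mu> * \<bar>x $ i\<bar> - g $ i * (y $ i - x $ i))"
    by (simp add: l1_norm_def inner_vec_def sum_distrib_left sum_subtractf)
  also have "\<dots> \<le> \<mu> * l1_norm y"
    unfolding l1_norm_def sum_distrib_left by (intro sum_mono comp)
  finally show "h (a\<^sup>2 - b\<^sup>2) + \<mu> * l1_norm (a\<^sup>2 - b\<^sup>2) \<le> h y + \<mu> * l1_norm y"
    using convex_on_above_gradient[OF conv gderiv_gradient[OF h], of x y]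
    by (simp add: g_def x_def)
qed

section \<open>Finiteness of the gradients at stationary points, and the spectral gap\<close>

text \<open>In each coordinate either both square differences are 0 or stationarity prescribes the
  same gradient entry at both points. The gradients therefore agree on the displacement, and the two
  opposite tangent inequalities become equalities.\<close>

lemma stationary_lifted_gradient_eq:
  fixes h :: "real ^ 'n \<Rightarrow> real"
  assumes h: "\<And>x. h differentiable (at x)" and conv: "convex_on UNIV h"
    and st: "stationary_point (lifted h \<mu>) (a, b)" and st': "stationary_point (lifted h \<mu>) (a', b')"
    and supp: "\<And>i. a $ i = 0 \<longleftrightarrow> a' $ i = 0" "\<And>i. b $ i = 0 \<longleftrightarrow> b' $ i = 0"
  shows "gradient h (a'\<^sup>2 - b'\<^sup>2) = gradient h (a\<^sup>2 - b\<^sup>2)"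
proof -
  let ?x = "a\<^sup>2 - b\<^sup>2" and ?y = "a'\<^sup>2 - b'\<^sup>2"
  have "gradient h ?x $ i * (?y - ?x) $ i = gradient h ?y $ i * (?y - ?x) $ i" for i
    using st[unfolded stationary_point_lifted_iff[OF h], rule_format, of i]
      st'[unfolded stationary_point_lifted_iff[OF h], rule_format, of i] supp[of i]
    by (cases "a $ i = 0"; cases "b $ i = 0") (auto simp: vec_power2_component)
  then have "gradient h ?x \<bullet> (?y - ?x) = gradient h ?y \<bullet> (?y - ?x)"
    unfolding inner_vec_def by (intro sum.cong) auto
  moreover have "gradient h ?y \<bullet> (?x - ?y) = - (gradient h ?y \<bullet> (?y - ?x))"
    by (simp add: inner_diff_right)
  ultimately have "h ?y = h ?x + gradient h ?x \<bullet> (?y - ?x)"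
    using convex_on_above_gradient[OF conv gderiv_gradient[OF h], of ?x ?y]
      convex_on_above_gradient[OF conv gderiv_gradient[OF h], of ?y ?x] by simp
  then show ?thesis
    by (rule convex_tangent_gradient_eq[OF conv gderiv_gradient[OF h] gderiv_gradient[OF h]])
qed

lemma finite_stationary_lifted_gradients:
  fixes h :: "real ^ 'n \<Rightarrow> real"
  assumes h: "\<And>x. h differentiable (at x)" and conv: "convex_on UNIV h"
  shows "finite {gradient h (a\<^sup>2 - b\<^sup>2) |a b. stationary_point (lifted h \<mu>) (a, b)}"
proof -
  define Z where "Z = {z. stationary_point (lifted h \<mu>) z}"
  define G where "G = (\<lambda>z. gradient h ((fst z)\<^sup>2 - (snd z)\<^sup>2))"
  \<comment> \<open>Records the supports through their complements. There are finitely many such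
    pairs, and \<open>inv_into\<close> picks one stationary point for each pair that occurs.\<close>
  define supp where "supp = (\<lambda>z :: (real ^ 'n) \<times> (real ^ 'n). ({i. fst z $ i = 0}, {i. snd z $ i = 0}))"
  have "G z = G (inv_into Z supp (supp z))" if "z \<in> Z" for z
  proof -
    let ?z = "inv_into Z supp (supp z)"
    have z: "?z \<in> Z" "supp ?z = supp z"
      using that by (auto intro: inv_into_into f_inv_into_f)
    then show ?thesis
      unfolding G_def using that
      by (intro stationary_lifted_gradient_eq[OF h conv, of \<mu>]) (auto simp: Z_def supp_def)
  qed
  then have "G ` Z \<subseteq> (\<lambda>p. G (inv_into Z supp p)) ` UNIV" by blast
  then have "finite (G ` Z)" by (rule finite_subset) simp
  moreover have "{gradient h (a\<^sup>2 - b\<^sup>2) |a b. stationary_point (lifted h \<mu>) (a, b)} = G ` Z"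
    by (force simp: G_def Z_def image_iff)
  ultimately show ?thesis by simp
qed

lemma finite_negative_gap:
  fixes N :: "real set"
  assumes "finite N"
  shows "\<exists>\<delta>>0. \<forall>r\<in>N. r > - \<delta> \<longrightarrow> r \<ge> 0"
proof -
  \<comment> \<open>The 1 keeps the set nonempty when \<open>N\<close> has no negative
    element.\<close>
  define \<delta> where "\<delta> = Min (insert 1 (uminus ` {r \<in> N. r < 0}))"
  have "\<delta> > 0" unfolding \<delta>_def using assms by (subst Min_gr_iff) auto
  moreover have "\<delta> \<le> - r" if "r \<in> N" "r < 0" for r
    unfolding \<delta>_def using assms that by (intro Min_le) auto
  ultimately show ?thesis by force
qed

section \<open>The equivalences\<close>

text \<open>Proved as the cycle (i) to (iii) to (iv) to (i); statement (ii) is joined by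
  \<open>global_minimizer_lifted_iff\<close>.\<close>

lemma lifted_equivalences:
  fixes h :: "real ^ 'n \<Rightarrow> real"
  assumes h: "\<And>x. h differentiable (at x)" "\<And>x. gradient h differentiable (at x)"
    and conv: "convex_on UNIV h" and mu: "\<mu> > 0"
  defines "F \<equiv> lifted h \<mu>"
  shows "\<exists>\<delta>>0. \<forall>a b.
    (stationary_point F (a, b) \<and> lambda_min (hessian F (a, b)) > - \<delta> \<longleftrightarrow> global_minimizer F (a, b)) \<and>
    (global_minimizer F (a, b) \<longleftrightarrow> second_order_stationary_point F (a, b))"
proof -
  define S where "S = {gradient h (a\<^sup>2 - b\<^sup>2) |a b. stationary_point F (a, b)}"
  \<comment> \<open>Contains the eigenvalues from \<open>hessian_lifted_eigenvectors\<close> at all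
    stationary points simultaneously, so that \<delta> does not depend on the point.\<close>
  define N where "N = (\<Union>g\<in>S. \<Union>i. {2 * (\<mu> + g $ i), 2 * (\<mu> - g $ i)})"
  have "finite N"
    using finite_stationary_lifted_gradients[OF h(1) conv] by (simp add: N_def S_def F_def)
  then obtain \<delta> where \<delta>: "\<delta> > 0" and gap: "\<And>r. r \<in> N \<Longrightarrow> r > - \<delta> \<Longrightarrow> r \<ge> 0"
    using finite_negative_gap by blast
  have F: "F differentiable (at z)" for z
    using gderiv_lifted[OF h(1)] unfolding F_def gderiv_def differentiable_def by blast
  have G: "gradient F differentiable (at z)" for z
    unfolding F_def by (rule gradient_lifted_differentiable[OF h])
  note sa = hessian_self_adjoint[OF F G]
  have min: "global_minimizer F (a, b)"
    if st: "stationary_point F (a, b)" and lam: "lambda_min (hessian F (a, b)) > - \<delta>" for a b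
  proof -
    let ?g = "gradient h (a\<^sup>2 - b\<^sup>2)"
    have st': "(a $ i = 0 \<or> ?g $ i = - \<mu>) \<and> (b $ i = 0 \<or> ?g $ i = \<mu>)" for i
      using st stationary_point_lifted_iff[OF h(1)] by (simp add: F_def)
    \<comment> \<open>Unless both coordinates vanish, stationarity gives equality. If both vanish,
      two Hessian eigenvalues lie in \<open>N\<close> above -\<delta>, so the gap makes them
      nonnegative.\<close>
    have "\<bar>?g $ i\<bar> \<le> \<mu>" for i
    proof (cases "a $ i = 0 \<and> b $ i = 0")
      case True
      have N: "2 * (\<mu> + ?g $ i) \<in> N" "2 * (\<mu> - ?g $ i) \<in> N"
        using st by (auto simp: N_def S_def)
      have "lambda_min (hessian F (a, b)) \<le> 2 * (\<mu> + ?g $ i)"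
        by (rule lambda_min_le_eigenvalue[OF sa, of "(axis i 1, 0)"])
           (use True hessian_lifted_eigenvectors[OF h] in \<open>auto simp: F_def zero_prod_def axis_eq_0_iff\<close>)
      moreover have "lambda_min (hessian F (a, b)) \<le> 2 * (\<mu> - ?g $ i)"
        by (rule lambda_min_le_eigenvalue[OF sa, of "(0, axis i 1)"])
           (use True hessian_lifted_eigenvectors[OF h] in \<open>auto simp: F_def zero_prod_def axis_eq_0_iff\<close>)
      ultimately have "0 \<le> 2 * (\<mu> + ?g $ i)" "0 \<le> 2 * (\<mu> - ?g $ i)"
        using lam by (intro gap N; linarith)+
      then show ?thesis by (simp add: abs_le_iff)
    qed (use st'[of i] mu in auto)
    \<comment> \<open>Two nonzero coordinates at the same index would force \<mu> = -\<mu>.\<close>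
    moreover have "vec_min (a\<^sup>2) (b\<^sup>2) = 0"
      unfolding vec_eq_iff
    proof
      fix i
      show "vec_min (a\<^sup>2) (b\<^sup>2) $ i = 0 $ i"
        using st'[of i] mu by (auto simp: vec_min_def vec_power2_component)
    qed
    ultimately show ?thesis
      using stationary_lifted_imp_minimizer[OF h(1) conv] st mu
      by (simp add: F_def global_minimizer_lifted_iff)
  qed
  have second: "second_order_stationary_point F z" if "global_minimizer F z" for z
    using global_minimizer_second_order[OF that F G] .
  have first: "stationary_point F z \<and> lambda_min (hessian F z) > - \<delta>"
    if "second_order_stationary_point F z" for z
    using that lambda_min_nonneg[OF linear_hessian[OF G] sa, of z] \<delta>
    by (simp add: second_order_stationary_point_def)
  show ?thesis using \<delta> min second first by blast
qed

theorem proposition3p3: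
  fixes h f :: "real ^ 'n \<Rightarrow> real"
    and F :: "(real ^ 'n) \<times> (real ^ 'n) \<Rightarrow> real"
    and \<mu> :: real
  assumes "C2 h"
    and "convex_on UNIV h"
    and "\<mu> > 0"
    and "\<And>x. f x = h x + \<mu> * l1_norm x"
    and "\<And>a b. F (a, b) = h (a\<^sup>2 - b\<^sup>2) + \<mu> * (\<Sum>i\<in>UNIV. (a $ i)\<^sup>2 + (b $ i)\<^sup>2)"
  shows "\<exists>\<delta>>0. \<forall>a b.
    ((stationary_point F (a, b) \<and> lambda_min (hessian F (a, b)) > - \<delta>)
        \<longleftrightarrow> (global_minimizer f (a\<^sup>2 - b\<^sup>2) \<and> vec_min (a\<^sup>2) (b\<^sup>2) = 0)) \<and>
    ((global_minimizer f (a\<^sup>2 - b\<^sup>2) \<and> vec_min (a\<^sup>2) (b\<^sup>2) = 0)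
        \<longleftrightarrow> global_minimizer F (a, b)) \<and>
    (global_minimizer F (a, b) \<longleftrightarrow> second_order_stationary_point F (a, b))"
proof -
  have f: "f = (\<lambda>x. h x + \<mu> * l1_norm x)" using assms(4) by blast
  have F: "F = lifted h \<mu>" using assms(5) by (auto simp: lifted_def)
  have "h differentiable (at x)" "gradient h differentiable (at x)" for x
    using assms(1) by (auto simp: C2_def differentiable_on_def)
  from lifted_equivalences[OF this assms(2,3)]
  \<comment> \<open>The rewriting turns (iii) into (ii), so the middle equivalence becomes
    trivial.\<close>
  show ?thesis unfolding f F global_minimizer_lifted_iff[OF assms(3)] by simp
qed

end
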